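(* Let $a<b$ be real numbers, $\delta \in (0,1)$, $\varepsilon_a > 0$ and $\varepsilon_r \in (0,1)$, and let $\mathscr{M}$, $\vartheta$, $g$, $h$, $\mathcal{W}$ be the functions defined in the context. (i) Let $n$ be a positive integer with $$n \geq \frac{\ln \frac{\delta}{2}}{\max_{\nu \in [a,b]} \mathcal{W}(\nu)}.$$ Then for any $\mu \in [a,b]$ and any random variables $X_1, X_2, \ldots$ on a probability space $(\Omega, \mathscr{F}, \Pr)$ such that, for every positive integer $k$, almost surely $a \leq X_k \leq b$ and $\mathbb{E}[X_k \mid \mathscr{F}_{k-1}] = \mu$ (where $\mathscr{F}_0 = \{\emptyset,\Omega\}$ and $\mathscr{F}_k$ is the $\sigma$-algebra generated by $X_1,\ldots,X_k$), the estimator $\widehat{\boldsymbol{\mu}} = \frac{1}{n}\sum_{i=1}^n X_i$ satisfies $$\Pr\left\{ |\widehat{\boldsymbol{\mu}} - \mu| < \varepsilon_a \ \text{ or } \ |\widehat{\boldsymbol{\mu}} - \mu| < \varepsilon_r |\mu| \right\} > 1 - \delta.$$ (ii) Moreover, $$\mathcal{W}(\nu) \leq \max\left\{ \mathscr{M}(g(d), \vartheta(c)), \ \mathscr{M}(h(c), \vartheta(d)) \right\},$$ $$\mathcal{W}(\nu) \geq \max\left\{ \mathscr{M}(g(c), \vartheta(d)), \ \mathscr{M}(h(d), \vartheta(c)) \right\}$$ for all $\nu \in [c,d] \subseteq [a,b]$ such that $g(d) \leq \vartheta(c) \leq \vartheta(d) \leq h(c)$.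
   Context: The function $\mathscr{M}(z,\theta)$, with values in $[-\infty, 0]$, is defined by $$\mathscr{M}(z,\theta) = \begin{cases} z \ln\frac{\theta}{z} + (1-z)\ln\frac{1-\theta}{1-z} & \text{for } z \in (0,1),\ \theta \in (0,1),\\ \ln(1-\theta) & \text{for } z = 0,\ \theta \in (0,1),\\ \ln\theta & \text{for } z = 1,\ \theta \in (0,1),\\ -\infty & \text{for } z \in [0,1],\ \theta \notin (0,1),\\ -\infty & \text{for } z \notin [0,1].\end{cases}$$ For $\mu \in [a,b]$ define $$\vartheta(\mu) = \frac{\mu - a}{b-a}, \qquad g(\mu) = \vartheta(\mu) - \frac{\max\{\varepsilon_a, \varepsilon_r|\mu|\}}{b-a}, \qquad h(\mu) = \vartheta(\mu) + \frac{\max\{\varepsilon_a, \varepsilon_r|\mu|\}}{b-a},$$ $$\mathcal{W}(\mu) = \max\left\{ \mathscr{M}(g(\mu), \vartheta(\mu)), \ \mathscr{M}(h(\mu), \vartheta(\mu)) \right\}.$$ If $\max_{\nu\in[a,b]} \mathcal{W}(\nu) = -\infty$, the quotient in the sample size condition is read as $0$. The $X_k$ are not assumed independent or identically distributed.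
   Formalization: The upper bound on W(ν) in (ii) is stated except when g(ν)=0 and ϑ(c)=0 (so c=a, ν=d), or h(ν)=1 and ϑ(d)=1 (so d=b, ν=c), where it can fail because M(0,0)=M(1,1)=−∞. *)

theory Defs
  imports "HOL-Probability.Probability"
begin

definition bernM :: "real \<Rightarrow> real \<Rightarrow> ereal" where
  "bernM z \<theta> =
     (if z \<in> {0<..<1} \<and> \<theta> \<in> {0<..<1}
        then ereal (z * ln (\<theta> / z) + (1 - z) * ln ((1 - \<theta>) / (1 - z)))
      else if z = 0 \<and> \<theta> \<in> {0<..<1} then ereal (ln (1 - \<theta>))
      else if z = 1 \<and> \<theta> \<in> {0<..<1} then ereal (ln \<theta>)
      else - \<infinity>)"

definition theta :: "real \<Rightarrow> real \<Rightarrow> real \<Rightarrow> real" where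
  "theta a b \<mu> = (\<mu> - a) / (b - a)"

definition gfun :: "real \<Rightarrow> real \<Rightarrow> real \<Rightarrow> real \<Rightarrow> real \<Rightarrow> real" where
  "gfun a b \<epsilon>a \<epsilon>r \<mu> = theta a b \<mu> - max \<epsilon>a (\<epsilon>r * \<bar>\<mu>\<bar>) / (b - a)"

definition hfun :: "real \<Rightarrow> real \<Rightarrow> real \<Rightarrow> real \<Rightarrow> real \<Rightarrow> real" where
  "hfun a b \<epsilon>a \<epsilon>r \<mu> = theta a b \<mu> + max \<epsilon>a (\<epsilon>r * \<bar>\<mu>\<bar>) / (b - a)"

definition Wfun :: "real \<Rightarrow> real \<Rightarrow> real \<Rightarrow> real \<Rightarrow> real \<Rightarrow> ereal" where
  "Wfun a b \<epsilon>a \<epsilon>r \<mu> =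
     max (bernM (gfun a b \<epsilon>a \<epsilon>r \<mu>) (theta a b \<mu>))
         (bernM (hfun a b \<epsilon>a \<epsilon>r \<mu>) (theta a b \<mu>))"

text \<open>
  The maximum of \<^term>\<open>Wfun a b \<epsilon>a \<epsilon>r\<close> over \<^term>\<open>{a..b}\<close> is rendered as a supremum in
  \<^typ>\<open>ereal\<close>: the function is upper semicontinuous there, so the supremum is attained. A
  quotient with denominator \<^term>\<open>- \<infinity> :: ereal\<close> is 0 by the convention of the library:
\<close>

lemma ereal_divide_MInfty: "ereal x / (- \<infinity>) = 0"
  by simp

text \<open>
  The upper bound on \<^term>\<open>Wfun a b \<epsilon>a \<epsilon>r \<nu>\<close> over a subinterval fails in two corner cases,
  because \<^term>\<open>bernM 0 0\<close> and \<^term>\<open>bernM 1 1\<close> are \<^term>\<open>- \<infinity> :: ereal\<close>: if \<open>g(\<nu>) = 0\<close> and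
  \<open>\<theta>(c) = 0\<close> (so \<open>\<nu> = d\<close> and \<open>c = a\<close>), or if \<open>h(\<nu>) = 1\<close> and \<open>\<theta>(d) = 1\<close> (so \<open>\<nu> = c\<close> and
  \<open>d = b\<close>). The next lemma is an instance of the first, with \<open>\<nu> = d\<close>; it is the reason why
  the upper bound is stated away from these two cases.
\<close>

lemma Wfun_upper_bound_corner_case:
  fixes a b \<epsilon>a \<epsilon>r c d :: real
  defines "a \<equiv> - 6" and "b \<equiv> - 13 / 4" and "\<epsilon>a \<equiv> 1" and "\<epsilon>r \<equiv> 1 / 2" and "c \<equiv> - 6" and "d \<equiv> - 4"
  shows "{c..d} \<subseteq> {a..b}"
    and "gfun a b \<epsilon>a \<epsilon>r d \<le> theta a b c"
    and "theta a b c \<le> theta a b d"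
    and "theta a b d \<le> hfun a b \<epsilon>a \<epsilon>r c"
    and "\<not> Wfun a b \<epsilon>a \<epsilon>r d \<le>
           max (bernM (gfun a b \<epsilon>a \<epsilon>r d) (theta a b c))
               (bernM (hfun a b \<epsilon>a \<epsilon>r c) (theta a b d))"
  by (simp_all add: assms Wfun_def gfun_def hfun_def theta_def bernM_def)

text \<open>
  The \<sigma>-algebra generated by \<open>X 1, \<dots>, X k\<close>. Generating it from preimages over the whole of
  \<^term>\<open>space P\<close> makes \<open>k = 0\<close> the trivial \<sigma>-algebra; \<open>X 0\<close> is never used.
\<close>

definition gen_alg :: "'w measure \<Rightarrow> (nat \<Rightarrow> 'w \<Rightarrow> real) \<Rightarrow> nat \<Rightarrow> 'w measure" where
  "gen_alg P X k = sigma (space P) (\<Union>i\<in>{1..k}. {X i -` B \<inter> space P | B. B \<in> sets borel})"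

lemma sets_gen_alg_0: "sets (gen_alg P X 0) = {{}, space P}"
  by (simp add: gen_alg_def sigma_sets_empty_eq)

lemma subalgebra_gen_alg:
  assumes "\<And>i. i \<ge> 1 \<Longrightarrow> X i \<in> borel_measurable P"
  shows "subalgebra P (gen_alg P X k)"
proof -
  have "(\<Union>i\<in>{1..k}. {X i -` B \<inter> space P | B. B \<in> sets borel}) \<subseteq> sets P"
    using assms by (auto simp: measurable_sets)
  then show ?thesis
    unfolding subalgebra_def gen_alg_def
    by (simp add: space_measure_of_conv sets.sigma_sets_subset sets_measure_of_conv)
qed

end

theory Submission imports Defs "HOL-Real_Asymp.Real_Asymp" begin

text \<open>
  Since \<open>exp (t x)\<close> lies below its chord on \<open>[a, b]\<close>, conditioning successively on the past bounds
  the moment generating function of the normalised sum \<open>(\<Sum> X\<^sub>i - n a) / (b - a)\<close> by that of a binomial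
  variable with parameter \<open>\<theta>(\<mu>)\<close>. Chernoff's method then bounds the upper and the lower tail by
  \<open>exp (n \<M>(h, \<theta>))\<close> and \<open>exp (n \<M>(g, \<theta>))\<close>, and the sample size condition makes both at most
  \<open>\<delta> / 2\<close>. The inequality \<open>\<M>(z, \<theta>) \<le> - (z - \<theta>)\<^sup>2 / 4\<close> keeps the maximum of \<open>\<W>\<close> away from \<open>0\<close>, so
  that the condition has content. A tail bound is strict unless \<open>h = 1\<close>, respectively \<open>g = 0\<close>; if both
  hold, \<open>\<mu>\<close> is the midpoint, which is not a maximiser of \<open>\<W>\<close>, and strictness comes from the sample
  size condition instead. The bounds on \<open>\<W>\<close> follow from the monotonicity of \<open>g\<close>, \<open>h\<close> and \<open>\<theta>\<close>
  and from that of \<open>\<M>\<close> in each argument on either side of the diagonal.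
\<close>

subsection \<open>The binomial relative entropy\<close>

text \<open>Minus the Kullback-Leibler divergence of two Bernoulli laws. At \<open>z = 0\<close> and
  \<open>z = 1\<close> the degenerate logarithm has factor 0, so one formula also covers the corner
  cases of \<open>bernM\<close>.\<close>

definition neg_kl :: "real \<Rightarrow> real \<Rightarrow> real" where
  "neg_kl z t = z * ln (t / z) + (1 - z) * ln ((1 - t) / (1 - z))"

lemma bernM_eq_neg_kl:
  "bernM z t = (if 0 \<le> z \<and> z \<le> 1 \<and> 0 < t \<and> t < 1 then ereal (neg_kl z t) else - \<infinity>)"
  by (auto simp: bernM_def neg_kl_def)

lemma neg_kl_reflect: "neg_kl (1 - z) (1 - t) = neg_kl z t"
  by (simp add: neg_kl_def)

text \<open>Exchanging success and failure; this carries facts about one side of the diagonal to the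
  other, and upper tails to lower tails.\<close>

lemma bernM_reflect: "bernM (1 - z) (1 - t) = bernM z t"
  by (auto simp: bernM_eq_neg_kl neg_kl_reflect)

text \<open>From \<open>ln x = 2 * ln (sqrt x)\<close> and \<open>ln y \<le> y - 1\<close>; the
  square roots prepare a Hellinger distance.\<close>

lemma mult_ln_divide_le:
  fixes z t :: real
  assumes "0 \<le> z" "0 < t"
  shows "z * ln (t / z) \<le> 2 * (sqrt z * sqrt t - z)"
proof (cases "z = 0")
  case False
  then have z: "z > 0" using assms by simp
  have "ln (t / z) = 2 * ln (sqrt (t / z))"
    using z assms by (simp add: ln_sqrt)
  also have "\<dots> \<le> 2 * (sqrt (t / z) - 1)"
    using z assms ln_le_minus_one[of "sqrt (t / z)"] by simp
  finally have "z * ln (t / z) \<le> z * (2 * (sqrt (t / z) - 1))"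
    using z by (intro mult_left_mono) auto
  also have "z * sqrt (t / z) = sqrt z * sqrt t"
    using z by (simp add: real_sqrt_divide field_simps)
  then have "z * (2 * (sqrt (t / z) - 1)) = 2 * (sqrt z * sqrt t - z)"
    by (simp add: algebra_simps)
  finally show ?thesis .
qed simp

text \<open>The divergence dominates the squared Hellinger distance, of which only
  \<open>(?u - ?v)\<^sup>2\<close> is kept. The constant comes from
  \<open>z - t = (?u + ?v) * (?u - ?v)\<close> and \<open>?u + ?v \<le> 2\<close>.\<close>

lemma neg_kl_le_neg_square:
  assumes "0 \<le> z" "z \<le> 1" "0 < t" "t < 1"
  shows "neg_kl z t \<le> - ((z - t)\<^sup>2 / 4)"
proof -
  let ?u = "sqrt z" and ?v = "sqrt t" and ?p = "sqrt (1 - z)" and ?q = "sqrt (1 - t)"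
  have sq: "?u\<^sup>2 = z" "?v\<^sup>2 = t" "?p\<^sup>2 = 1 - z" "?q\<^sup>2 = 1 - t"
    using assms by auto
  have "neg_kl z t \<le> 2 * (?u * ?v - z) + 2 * (?p * ?q - (1 - z))"
    unfolding neg_kl_def using assms by (intro add_mono mult_ln_divide_le) auto
  moreover have "2 * (?p * ?q) \<le> ?p\<^sup>2 + ?q\<^sup>2"
    using sum_squares_bound[of ?p ?q] by simp
  moreover have "(?u - ?v)\<^sup>2 = z + t - 2 * (?u * ?v)"
    by (simp add: power2_diff sq)
  ultimately have "neg_kl z t \<le> - (?u - ?v)\<^sup>2"
    using sq by argo
  moreover have "(z - t)\<^sup>2 \<le> 4 * (?u - ?v)\<^sup>2"
  proof -
    have "z - t = (?u + ?v) * (?u - ?v)"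
      using sq by (simp add: algebra_simps power2_eq_square)
    then have "(z - t)\<^sup>2 = (?u + ?v)\<^sup>2 * (?u - ?v)\<^sup>2"
      by (simp add: power_mult_distrib)
    also have "(?u + ?v)\<^sup>2 \<le> 2\<^sup>2"
      using assms add_mono[of ?u 1 ?v 1] by (intro power_mono) auto
    finally show ?thesis by (simp add: mult_right_mono)
  qed
  ultimately show ?thesis by argo
qed

lemma neg_kl_nonpos:
  assumes "0 \<le> z" "z \<le> 1" "0 < t" "t < 1"
  shows "neg_kl z t \<le> 0"
  using neg_kl_le_neg_square[OF assms] zero_le_power2[of "z - t"] by linarith

text \<open>In the first difference the entropy of \<open>z\<close> cancels; the second is the
  three-point identity of a Bregman divergence, whose remainder \<open>neg_kl z s\<close> has a
  known sign.\<close>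

lemma neg_kl_expand:
  assumes "0 \<le> z" "z \<le> 1" "0 < t" "t < 1" "0 < s" "s < 1"
  shows "neg_kl z t - neg_kl z s = z * ln (t / s) + (1 - z) * ln ((1 - t) / (1 - s))"
    and "neg_kl z t - neg_kl s t = neg_kl z s + (z - s) * (ln (t / s) - ln ((1 - t) / (1 - s)))"
proof -
  \<comment> \<open>The case \<open>x = 0\<close>, where the quotient rule for \<open>ln\<close>
    fails, is what admits the boundary values of \<open>z\<close>.\<close>
  have *: "x * ln (y / x) = x * ln y - x * ln x" if "0 \<le> x" "0 < y" for x y :: real
    using that by (cases "x = 0") (auto simp: ln_div algebra_simps)
  have E: "neg_kl x y = x * ln y - x * ln x + ((1 - x) * ln (1 - y) - (1 - x) * ln (1 - x))"
    if "0 \<le> x" "x \<le> 1" "0 < y" "y < 1" for x y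
    unfolding neg_kl_def using that by (simp add: *)
  show "neg_kl z t - neg_kl z s = z * ln (t / s) + (1 - z) * ln ((1 - t) / (1 - s))"
    using assms by (simp add: E ln_div algebra_simps)
  show "neg_kl z t - neg_kl s t = neg_kl z s + (z - s) * (ln (t / s) - ln ((1 - t) / (1 - s)))"
    using assms by (simp add: E ln_div algebra_simps)
qed

text \<open>Applying \<open>ln x \<le> x - 1\<close> to both logarithms leaves a rational expression
  that factors with a visible sign.\<close>

lemma neg_kl_antimono_right:
  assumes "0 \<le> z" "z \<le> s" "s \<le> t" "0 < s" "t < 1"
  shows "neg_kl z t \<le> neg_kl z s"
proof -
  have "ln (t / s) \<le> t / s - 1" "ln ((1 - t) / (1 - s)) \<le> (1 - t) / (1 - s) - 1"
    using assms by (intro ln_le_minus_one; simp)+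
  then have "neg_kl z t - neg_kl z s \<le> z * (t / s - 1) + (1 - z) * ((1 - t) / (1 - s) - 1)"
    using assms by (subst neg_kl_expand(1)) (auto intro!: add_mono mult_left_mono)
  also have "\<dots> = - ((t - s) * (s - z) / (s * (1 - s)))"
    using assms by (simp add: field_simps)
  also have "\<dots> \<le> 0"
    using assms by simp
  finally show ?thesis by simp
qed

text \<open>Both terms on the right of the three-point identity are nonpositive. That identity
  requires \<open>0 < s\<close>; for \<open>s = 0\<close> also \<open>z = 0\<close>.\<close>

lemma neg_kl_mono_left:
  assumes "0 \<le> z" "z \<le> s" "s \<le> t" "0 < t" "t < 1"
  shows "neg_kl z t \<le> neg_kl s t"
proof (cases "s = 0")
  case False
  then have s: "0 < s" "s < 1" using assms by auto
  have "ln (t / s) \<ge> 0"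
    using assms s by simp
  moreover have "ln ((1 - t) / (1 - s)) \<le> 0"
    using assms s by simp
  ultimately have "(z - s) * (ln (t / s) - ln ((1 - t) / (1 - s))) \<le> 0"
    using assms(2) by (intro mult_nonpos_nonneg; linarith)
  moreover have "neg_kl z s \<le> 0"
    using assms s by (intro neg_kl_nonpos) auto
  ultimately show ?thesis
    using neg_kl_expand(2)[of z t s] assms s by simp
qed (use assms in simp)

text \<open>First the second argument moves from \<open>u\<close> down to \<open>t\<close>, then the
  first from \<open>z\<close> up to \<open>s\<close>, on one side of the diagonal throughout. The
  origin is excluded because \<open>bernM\<close> drops to minus infinity there.\<close>

lemma bernM_mono:
  assumes "z \<le> s" "s \<le> t" "t \<le> u" "\<not> (s = 0 \<and> t = 0)"
  shows "bernM z u \<le> bernM s t"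
proof (cases "0 \<le> z \<and> u < 1")
  case True
  then have *: "0 < t" "t < 1" using assms by auto
  have "neg_kl z u \<le> neg_kl z t"
    using assms True * by (intro neg_kl_antimono_right) auto
  also have "neg_kl z t \<le> neg_kl s t"
    using assms True * by (intro neg_kl_mono_left) auto
  finally show ?thesis using assms True * by (simp add: bernM_eq_neg_kl)
qed (auto simp: bernM_eq_neg_kl)

lemma bernM_mono_upper:
  assumes "u \<le> t" "t \<le> s" "s \<le> z" "\<not> (s = 1 \<and> t = 1)"
  shows "bernM z u \<le> bernM s t"
  using bernM_mono[of "1 - z" "1 - s" "1 - t" "1 - u"] assms by (simp add: bernM_reflect)

lemma bernM_le:
  assumes "\<bar>z - t\<bar> \<ge> e" "e \<ge> 0"
  shows "bernM z t \<le> ereal (- (e\<^sup>2 / 4))"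
proof -
  have "e\<^sup>2 \<le> (z - t)\<^sup>2"
    using power_mono[OF assms(1), of 2] assms(2) by simp
  then have "neg_kl z t \<le> - (e\<^sup>2 / 4)" if "0 \<le> z" "z \<le> 1" "0 < t" "t < 1"
    using neg_kl_le_neg_square[OF that] by argo
  then show ?thesis by (auto simp: bernM_eq_neg_kl)
qed

lemma neg_kl_quarter: "neg_kl (1/4) (3/4) = - ln 3 / 2"
  by (simp add: neg_kl_def ln_div field_simps)

section \<open>The functions \<open>theta\<close>, \<open>gfun\<close>, \<open>hfun\<close> and
  \<open>Wfun\<close>\<close>

lemma theta_bounds:
  assumes "a < b" "x \<in> {a..b}"
  shows "0 \<le> theta a b x" "theta a b x \<le> 1"
  using assms by (auto simp: theta_def field_simps)

lemma theta_mono: "a < b \<Longrightarrow> x \<le> y \<Longrightarrow> theta a b x \<le> theta a b y"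
  by (simp add: theta_def divide_right_mono)

text \<open>Hence \<open>r < 1\<close> makes \<open>g\<close> and \<open>h\<close> increase along with \<open>\<theta>\<close>.\<close>

lemma tolerance_lipschitz:
  fixes x y :: real
  assumes "0 < r" "x \<le> y"
  shows "\<bar>max e (r * \<bar>y\<bar>) - max e (r * \<bar>x\<bar>)\<bar> \<le> r * (y - x)"
proof -
  have "\<bar>max e p - max e q\<bar> \<le> \<bar>p - q\<bar>" for p q :: real by auto
  then have "\<bar>max e (r * \<bar>y\<bar>) - max e (r * \<bar>x\<bar>)\<bar> \<le> \<bar>r * \<bar>y\<bar> - r * \<bar>x\<bar>\<bar>" .
  also have "\<dots> = r * \<bar>\<bar>y\<bar> - \<bar>x\<bar>\<bar>"
    using assms by (simp add: abs_mult flip: right_diff_distrib)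
  also have "\<dots> \<le> r * (y - x)"
    using assms by (intro mult_left_mono) auto
  finally show ?thesis .
qed

lemma gfun_hfun_strict_mono:
  assumes "a < b" "0 < r" "r < 1" "x < y"
  shows "gfun a b e r x < gfun a b e r y" "hfun a b e r x < hfun a b e r y"
proof -
  have "r * (y - x) < y - x" using assms by simp
  then have "\<bar>max e (r * \<bar>y\<bar>) - max e (r * \<bar>x\<bar>)\<bar> < y - x"
    using tolerance_lipschitz[of r x y e] assms by linarith
  then show "gfun a b e r x < gfun a b e r y" "hfun a b e r x < hfun a b e r y"
    using assms
    by (auto simp: gfun_def hfun_def theta_def abs_less_iff
        simp flip: diff_divide_distrib add_divide_distrib intro!: divide_strict_right_mono)
qed

lemma gfun_hfun_mono:
  assumes "a < b" "0 < r" "r < 1" "x \<le> y"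
  shows "gfun a b e r x \<le> gfun a b e r y" "hfun a b e r x \<le> hfun a b e r y"
  using gfun_hfun_strict_mono[OF assms(1-3), of x y e] assms(4) by (cases "x = y"; simp)+

lemma gfun_hfun_gap:
  assumes "a < b" "0 < e"
  shows "gfun a b e r x \<le> theta a b x - e / (b - a)" "hfun a b e r x \<ge> theta a b x + e / (b - a)"
  using assms by (auto simp: gfun_def hfun_def intro!: divide_right_mono)

lemma gfun_less_theta:
  assumes "a < b" "0 < e"
  shows "gfun a b e r x < theta a b x" "theta a b x < hfun a b e r x"
  using gfun_hfun_gap[OF assms, where r = r and x = x] divide_pos_pos[of e "b - a"] assms by linarith+

text \<open>The tolerance is at least \<open>e\<close> everywhere, so the bound is uniform in
  \<open>x\<close> and keeps the supremum negative.\<close>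

lemma Wfun_le:
  assumes "a < b" "0 < e"
  shows "Wfun a b e r x \<le> ereal (- ((e / (b - a))\<^sup>2 / 4))"
  unfolding Wfun_def using gfun_hfun_gap[OF assms, where r = r and x = x] assms
  by (intro max.boundedI bernM_le) auto

text \<open>The assumptions on \<open>g(d)\<close> and \<open>h(c)\<close> keep the comparison
  points on their sides of the diagonal, where \<open>bernM\<close> is monotone.\<close>

lemma Wfun_upper_bound:
  assumes "a < b" "0 < e" "0 < r" "r < 1" "v \<in> {c..d}"
    and "gfun a b e r d \<le> theta a b c" "theta a b d \<le> hfun a b e r c"
    and "\<not> (gfun a b e r v = 0 \<and> theta a b c = 0)" "\<not> (hfun a b e r v = 1 \<and> theta a b d = 1)"
  shows "Wfun a b e r v \<le> max (bernM (gfun a b e r d) (theta a b c)) (bernM (hfun a b e r c) (theta a b d))"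
proof -
  have m: "gfun a b e r v \<le> gfun a b e r d" "hfun a b e r c \<le> hfun a b e r v"
    "theta a b c \<le> theta a b v" "theta a b v \<le> theta a b d"
    using assms by (auto intro!: gfun_hfun_mono theta_mono)
  have "bernM (gfun a b e r v) (theta a b v) \<le> bernM (gfun a b e r d) (theta a b c)"
  \<comment> \<open>For \<open>g(v) \<ge> 0\<close>, monotonicity makes \<open>g(d) = 0\<close>
    imply \<open>g(v) = 0\<close>, so excluding the corner at \<open>v\<close> also excludes it at
    \<open>d\<close>. For \<open>g(v) < 0\<close> the left side is minus infinity. The second term
    is symmetric.\<close>
  proof (cases "0 \<le> gfun a b e r v")
    case True
    then show ?thesis using assms m by (intro bernM_mono) auto
  qed (simp add: bernM_eq_neg_kl)
  moreover have "bernM (hfun a b e r v) (theta a b v) \<le> bernM (hfun a b e r c) (theta a b d)"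
  proof (cases "hfun a b e r v \<le> 1")
    case True
    then show ?thesis using assms m by (intro bernM_mono_upper) auto
  qed (simp add: bernM_eq_neg_kl)
  ultimately show ?thesis unfolding Wfun_def by (rule max.mono)
qed

text \<open>Now \<open>g(v)\<close> and \<open>h(v)\<close> are the inner points; their strict
  distance from \<open>theta a b v\<close> rules out the corner cases.\<close>

lemma Wfun_lower_bound:
  assumes "a < b" "0 < e" "0 < r" "r < 1" "v \<in> {c..d}"
  shows "max (bernM (gfun a b e r c) (theta a b d)) (bernM (hfun a b e r d) (theta a b c)) \<le> Wfun a b e r v"
proof -
  have "bernM (gfun a b e r c) (theta a b d) \<le> bernM (gfun a b e r v) (theta a b v)"
    using assms gfun_less_theta[OF assms(1,2), where r = r and x = v]
    by (intro bernM_mono gfun_hfun_mono theta_mono) auto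
  moreover have "bernM (hfun a b e r d) (theta a b c) \<le> bernM (hfun a b e r v) (theta a b v)"
    using assms gfun_less_theta[OF assms(1,2), where r = r and x = v]
    by (intro bernM_mono_upper gfun_hfun_mono theta_mono) auto
  ultimately show ?thesis unfolding Wfun_def by (rule max.mono)
qed

text \<open>
  When \<open>g(\<mu>) = 0\<close> and \<open>h(\<mu>) = 1\<close> the point \<open>\<mu>\<close> is the midpoint, and \<open>\<W>(\<mu>) = - ln 2\<close>. Moving a
  quarter of the interval towards \<open>0\<close> does not increase the tolerance beyond half the interval, so
  \<open>\<W>\<close> is at least \<open>\<M>(1/4, 3/4) = - ln 3 / 2\<close> there.
\<close>

lemma Wfun_off_midpoint:
  assumes "a < b" "0 < e" "0 < r" "r < 1" "gfun a b e r \<mu> = 0" "hfun a b e r \<mu> = 1"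
  obtains v where "v \<in> {a..b}" "ereal (- ln 3 / 2) \<le> Wfun a b e r v"
proof -
  define w where "w = max e (r * \<bar>\<mu>\<bar>)"
  have "theta a b \<mu> - w / (b - a) = 0" "theta a b \<mu> + w / (b - a) = 1"
    using assms(5,6) by (simp_all add: gfun_def hfun_def w_def)
  then have "theta a b \<mu> = 1/2" "w / (b - a) = 1/2" by linarith+
  then have mu: "\<mu> = (a + b) / 2" and w: "w = (b - a) / 2"
    using assms(1) by (simp_all add: theta_def field_simps)
  define q where "q = (b - a) / 4"
  define v where "v = (if \<mu> \<ge> 0 then \<mu> - q else \<mu> + q)"
  have q: "q > 0" using assms(1) by (simp add: q_def)
  \<comment> \<open>Either the shift stays on the same side of 0 and decreases the modulus, or it
    overshoots 0 by at most \<open>q\<close>, which is half of \<open>w\<close>.\<close>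
  have "\<bar>v\<bar> \<le> max \<bar>\<mu>\<bar> q" using q by (auto simp: v_def)
  then have "r * \<bar>v\<bar> \<le> max (r * \<bar>\<mu>\<bar>) (r * q)"
    using mult_left_mono[of "\<bar>v\<bar>" "max \<bar>\<mu>\<bar> q" r] assms(3) by (simp add: max_mult_distrib_left)
  also have "r * q \<le> q" using q assms(4) by simp
  then have "r * q \<le> w" using q w q_def by linarith
  then have "max (r * \<bar>\<mu>\<bar>) (r * q) \<le> w" by (simp add: w_def)
  finally have "max e (r * \<bar>v\<bar>) \<le> w" by (simp add: w_def)
  then have tol: "max e (r * \<bar>v\<bar>) / (b - a) \<le> 1/2"
    using assms(1) w by (simp add: field_simps)
  have v_in: "v \<in> {a..b}" using q by (auto simp: v_def mu q_def field_simps)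
  have "ereal (- ln 3 / 2) \<le> Wfun a b e r v"
  proof (cases "\<mu> \<ge> 0")
    case True
    then have th: "theta a b v = 1/4"
      using assms(1) by (simp add: v_def mu q_def theta_def field_simps)
    then have "hfun a b e r v \<le> 3/4" using tol unfolding hfun_def by linarith
    then have "bernM (3/4) (1/4) \<le> bernM (hfun a b e r v) (theta a b v)"
      using gfun_less_theta[OF assms(1,2), where r = r and x = v] th by (intro bernM_mono_upper) auto
    then show ?thesis using bernM_reflect[of "1/4" "3/4"]
      by (simp add: Wfun_def bernM_eq_neg_kl neg_kl_quarter le_max_iff_disj)
  next
    case False
    then have th: "theta a b v = 3/4"
      using assms(1) by (simp add: v_def mu q_def theta_def field_simps)
    then have "gfun a b e r v \<ge> 1/4" using tol unfolding gfun_def by linarith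
    then have "bernM (1/4) (3/4) \<le> bernM (gfun a b e r v) (theta a b v)"
      using gfun_less_theta[OF assms(1,2), where r = r and x = v] th by (intro bernM_mono) auto
    then show ?thesis
      by (simp add: Wfun_def bernM_eq_neg_kl neg_kl_quarter le_max_iff_disj)
  qed
  with v_in that show ?thesis by blast
qed

subsection \<open>Tail bounds for bounded sequences with constant conditional mean\<close>

text \<open>Convexity of \<open>exp\<close>. The bound is affine in \<open>x\<close>, so a
  conditional expectation of it depends only on the conditional mean.\<close>

lemma exp_le_chord:
  fixes a b x t :: real
  assumes "a < b" "a \<le> x" "x \<le> b"
  shows "exp (t * x) \<le> ((b - x) * exp (t * a) + (x - a) * exp (t * b)) / (b - a)"
proof -
  define u where "u = (x - a) / (b - a)"
  have u: "0 \<le> u" "u \<le> 1" "1 - u = (b - x) / (b - a)"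
    using assms by (simp_all add: u_def field_simps)
  have "exp ((1 - u) *\<^sub>R (t * a) + u *\<^sub>R (t * b)) \<le> (1 - u) * exp (t * a) + u * exp (t * b)"
    using u by (intro convex_onD[OF exp_convex]) auto
  moreover have "(1 - u) *\<^sub>R (t * a) + u *\<^sub>R (t * b) = t * (a + u * (b - a))"
    by (simp add: algebra_simps)
  moreover have "a + u * (b - a) = x"
    using assms by (simp add: u_def)
  ultimately show ?thesis
    using u(3) by (simp add: u_def add_divide_distrib)
qed

lemma measurable_gen_alg:
  assumes "i \<in> {1..k}"
  shows "X i \<in> borel_measurable (gen_alg P X k)"
proof (rule measurableI)
  fix B :: "real set" assume "B \<in> sets borel"
  then have "X i -` B \<inter> space P \<in> (\<Union>i\<in>{1..k}. {X i -` B \<inter> space P | B. B \<in> sets borel})"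
    using assms by blast
  moreover have "(\<Union>i\<in>{1..k}. {X i -` B \<inter> space P | B. B \<in> sets borel}) \<subseteq> Pow (space P)"
    by blast
  ultimately show "X i -` B \<inter> space (gen_alg P X k) \<in> sets (gen_alg P X k)"
    unfolding gen_alg_def by (simp add: sets_measure_of space_measure_of_conv)
qed simp

context prob_space
begin

context
  fixes a b \<mu> :: real and X :: "nat \<Rightarrow> 'a \<Rightarrow> real"
  assumes ab: "a < b" and mu: "\<mu> \<in> {a..b}"
    and meas: "\<And>k. k \<ge> 1 \<Longrightarrow> X k \<in> borel_measurable M"
    and bnd: "\<And>k. k \<ge> 1 \<Longrightarrow> AE \<omega> in M. a \<le> X k \<omega> \<and> X k \<omega> \<le> b"
    and cexp: "\<And>k. k \<ge> 1 \<Longrightarrow> AE \<omega> in M. real_cond_exp M (gen_alg M X (k - 1)) (X k) \<omega> = \<mu>"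
begin

lemma sum_measurable: "(\<lambda>\<omega>. \<Sum>i=1..n. X i \<omega>) \<in> borel_measurable M"
  using meas by (intro borel_measurable_sum) auto

lemma sum_bounded_AE: "AE \<omega> in M. real n * a \<le> (\<Sum>i=1..n. X i \<omega>) \<and> (\<Sum>i=1..n. X i \<omega>) \<le> real n * b"
proof -
  have "AE \<omega> in M. \<forall>i\<in>{1..n}. a \<le> X i \<omega> \<and> X i \<omega> \<le> b"
    using bnd by (intro AE_ball_countable[THEN iffD2]) auto
  then show ?thesis
  proof eventually_elim
    case (elim \<omega>)
    then show ?case
      using sum_bounded_below[of "{1..n}" a "\<lambda>i. X i \<omega>"] sum_bounded_above[of "{1..n}" "\<lambda>i. X i \<omega>" b]
      by auto
  qed
qed

lemma exp_sum_integrable: "integrable M (\<lambda>\<omega>. exp (t * (\<Sum>i=1..n. X i \<omega>)))"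
proof (rule integrable_const_bound)
  show "AE \<omega> in M. norm (exp (t * (\<Sum>i=1..n. X i \<omega>))) \<le> exp (\<bar>t\<bar> * (real n * (\<bar>a\<bar> + \<bar>b\<bar>)))"
    using sum_bounded_AE[of n]
  proof eventually_elim
    case (elim \<omega>)
    have "\<bar>real n * a\<bar> + \<bar>real n * b\<bar> = real n * (\<bar>a\<bar> + \<bar>b\<bar>)"
      by (simp add: abs_mult algebra_simps)
    then have "\<bar>\<Sum>i=1..n. X i \<omega>\<bar> \<le> real n * (\<bar>a\<bar> + \<bar>b\<bar>)"
      using elim by linarith
    then have "\<bar>t\<bar> * \<bar>\<Sum>i=1..n. X i \<omega>\<bar> \<le> \<bar>t\<bar> * (real n * (\<bar>a\<bar> + \<bar>b\<bar>))"
      by (intro mult_left_mono) auto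
    then show ?case using abs_ge_self[of "t * (\<Sum>i=1..n. X i \<omega>)"]
      unfolding abs_mult by simp
  qed
  show "(\<lambda>\<omega>. exp (t * (\<Sum>i=1..n. X i \<omega>))) \<in> borel_measurable M"
    using sum_measurable by measurable
qed

text \<open>By induction: the chord bounds the newest factor by an affine function of the newest
  variable, and conditioning on the past replaces that variable by \<open>\<mu>\<close>.\<close>

lemma mgf_sum_le:
  "(LINT \<omega>|M. exp (t * (\<Sum>i=1..n. X i \<omega>)))
     \<le> (((b - \<mu>) * exp (t * a) + (\<mu> - a) * exp (t * b)) / (b - a)) ^ n"
proof (induction n)
  case (Suc n)
  define F where "F = gen_alg M X n"
  define Y where "Y \<omega> = exp (t * (\<Sum>i=1..n. X i \<omega>))" for \<omega>
  define Z where "Z = X (Suc n)"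
  \<comment> \<open>Slope and intercept of the chord of \<open>exp (t * x)\<close> over
    \<open>[a, b]\<close>.\<close>
  define p where "p = (exp (t * b) - exp (t * a)) / (b - a)"
  define q where "q = (b * exp (t * a) - a * exp (t * b)) / (b - a)"
  have chord: "((b - x) * exp (t * a) + (x - a) * exp (t * b)) / (b - a) = p * x + q" for x
    by (simp add: p_def q_def algebra_simps flip: add_divide_distrib diff_divide_distrib)
  have sub: "subalgebra M F"
    unfolding F_def using meas by (rule subalgebra_gen_alg)
  interpret fs: finite_measure_subalgebra M F
    by unfold_locales (rule sub)
  have YF: "Y \<in> borel_measurable F"
  proof -
    have "(\<lambda>\<omega>. \<Sum>i=1..n. X i \<omega>) \<in> borel_measurable F"
      unfolding F_def by (intro borel_measurable_sum measurable_gen_alg)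
    then show ?thesis unfolding Y_def by measurable
  qed
  \<comment> \<open>With index \<open>Suc n\<close> the conditioning algebra is the one generated by
    the first \<open>n\<close> variables, that is, \<open>F\<close>.\<close>
  have Z: "Z \<in> borel_measurable M" "AE \<omega> in M. a \<le> Z \<omega> \<and> Z \<omega> \<le> b"
    "AE \<omega> in M. real_cond_exp M F Z \<omega> = \<mu>"
    using meas[of "Suc n"] bnd[of "Suc n"] cexp[of "Suc n"] by (simp_all add: Z_def F_def)
  have Yint: "integrable M Y"
    unfolding Y_def by (rule exp_sum_integrable)
  have YZint: "integrable M (\<lambda>\<omega>. Y \<omega> * Z \<omega>)"
  proof (rule Bochner_Integration.integrable_bound)
    show "integrable M (\<lambda>\<omega>. Y \<omega> * (\<bar>a\<bar> + \<bar>b\<bar>))" using Yint by simp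
    show "(\<lambda>\<omega>. Y \<omega> * Z \<omega>) \<in> borel_measurable M" using Yint Z(1) by measurable
    show "AE \<omega> in M. norm (Y \<omega> * Z \<omega>) \<le> norm (Y \<omega> * (\<bar>a\<bar> + \<bar>b\<bar>))"
      using Z(2) by eventually_elim (auto simp: abs_mult intro!: mult_left_mono)
  qed
  \<comment> \<open>\<open>Y\<close> is measurable with respect to \<open>F\<close>, so only
    \<open>Z\<close> is replaced by its conditional expectation.\<close>
  have "(LINT \<omega>|M. Y \<omega> * Z \<omega>) = (LINT \<omega>|M. Y \<omega> * real_cond_exp M F Z \<omega>)"
    using fs.real_cond_exp_intg(2)[OF YZint YF Z(1)] by simp
  also have "\<dots> = (LINT \<omega>|M. Y \<omega> * \<mu>)"
  proof (rule integral_cong_AE)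
    show "AE \<omega> in M. Y \<omega> * real_cond_exp M F Z \<omega> = Y \<omega> * \<mu>"
      using Z(3) by eventually_elim simp
  qed (use Yint in measurable)
  finally have EYZ: "(LINT \<omega>|M. Y \<omega> * Z \<omega>) = (LINT \<omega>|M. Y \<omega>) * \<mu>" by simp
  \<comment> \<open>The induction hypothesis is multiplied by this value of the chord, whose sign
    therefore matters.\<close>
  have ge: "0 \<le> p * \<mu> + q"
    using ab mu by (simp flip: chord)
  have "(LINT \<omega>|M. exp (t * (\<Sum>i=1..Suc n. X i \<omega>))) \<le> (LINT \<omega>|M. p * (Y \<omega> * Z \<omega>) + q * Y \<omega>)"
  proof (rule integral_mono_AE)
    show "integrable M (\<lambda>\<omega>. exp (t * (\<Sum>i=1..Suc n. X i \<omega>)))" by (rule exp_sum_integrable)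
    show "integrable M (\<lambda>\<omega>. p * (Y \<omega> * Z \<omega>) + q * Y \<omega>)" using YZint Yint by simp
    show "AE \<omega> in M. exp (t * (\<Sum>i=1..Suc n. X i \<omega>)) \<le> p * (Y \<omega> * Z \<omega>) + q * Y \<omega>"
      using Z(2)
    proof eventually_elim
      case (elim \<omega>)
      have "exp (t * (\<Sum>i=1..Suc n. X i \<omega>)) = Y \<omega> * exp (t * Z \<omega>)"
        by (simp add: Y_def Z_def algebra_simps flip: exp_add)
      also have "\<dots> \<le> Y \<omega> * (p * Z \<omega> + q)"
        using exp_le_chord[OF ab, of "Z \<omega>" t] elim unfolding chord
        by (intro mult_left_mono) (auto simp: Y_def)
      finally show ?case by (simp add: algebra_simps)
    qed
  qed
  also have "\<dots> = (LINT \<omega>|M. Y \<omega>) * (p * \<mu> + q)"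
    using YZint Yint EYZ by (simp add: algebra_simps)
  also have "\<dots> \<le> (p * \<mu> + q) ^ n * (p * \<mu> + q)"
    using Suc.IH ge unfolding chord Y_def by (intro mult_right_mono) auto
  finally show ?case unfolding chord by (simp add: mult.commute)
qed (simp add: prob_space)

text \<open>Rescaling each summand to \<open>[0, 1]\<close> turns the previous bound into the moment
  generating function of a binomial variable.\<close>

lemma mgf_normalized_sum:
  fixes t :: real and n :: nat
  defines "S \<equiv> \<lambda>\<omega>. ((\<Sum>i=1..n. X i \<omega>) - real n * a) / (b - a)"
  shows "S \<in> borel_measurable M"
    and "AE \<omega> in M. 0 \<le> S \<omega> \<and> S \<omega> \<le> real n"
    and "integrable M (\<lambda>\<omega>. exp (t * S \<omega>))"
    and "(LINT \<omega>|M. exp (t * S \<omega>)) \<le> (1 - theta a b \<mu> + theta a b \<mu> * exp t) ^ n"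
proof -
  show "S \<in> borel_measurable M"
    unfolding S_def using sum_measurable[of n] by measurable
  show "AE \<omega> in M. 0 \<le> S \<omega> \<and> S \<omega> \<le> real n"
    using sum_bounded_AE[of n] by eventually_elim (use ab in \<open>auto simp: S_def field_simps\<close>)
  \<comment> \<open>The parameter for the unscaled sum; the factors \<open>exp (u * a)\<close>
    produced by centring then cancel.\<close>
  define u where "u = t / (b - a)"
  have u: "u * b = u * a + t"
    using ab by (simp add: u_def field_simps)
  have S: "exp (t * S \<omega>) = exp (- (real n * (u * a))) * exp (u * (\<Sum>i=1..n. X i \<omega>))" for \<omega>
    by (simp add: S_def u_def right_diff_distrib diff_divide_distrib flip: exp_add)
  show "integrable M (\<lambda>\<omega>. exp (t * S \<omega>))"
    unfolding S using exp_sum_integrable by simp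
  have th: "1 - theta a b \<mu> + theta a b \<mu> * exp t = ((b - \<mu>) + (\<mu> - a) * exp t) / (b - a)"
  proof -
    have "1 - theta a b \<mu> = (b - \<mu>) / (b - a)"
      using ab by (simp add: theta_def field_simps)
    then show ?thesis by (simp add: theta_def add_divide_distrib)
  qed
  have "(LINT \<omega>|M. exp (t * S \<omega>)) = exp (- (real n * (u * a))) * (LINT \<omega>|M. exp (u * (\<Sum>i=1..n. X i \<omega>)))"
    unfolding S by simp
  also have "\<dots> \<le> exp (- (real n * (u * a))) * (((b - \<mu>) * exp (u * a) + (\<mu> - a) * exp (u * b)) / (b - a)) ^ n"
    by (intro mult_left_mono mgf_sum_le) auto
  also have "((b - \<mu>) * exp (u * a) + (\<mu> - a) * exp (u * b)) / (b - a)
      = exp (u * a) * (1 - theta a b \<mu> + theta a b \<mu> * exp t)"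
    unfolding th u by (simp add: exp_add algebra_simps)
  also have "exp (- (real n * (u * a))) * (exp (u * a) * (1 - theta a b \<mu> + theta a b \<mu> * exp t)) ^ n
      = (1 - theta a b \<mu> + theta a b \<mu> * exp t) ^ n"
    by (simp add: power_mult_distrib exp_minus flip: exp_of_nat_mult)
  finally show "(LINT \<omega>|M. exp (t * S \<omega>)) \<le> (1 - theta a b \<mu> + theta a b \<mu> * exp t) ^ n" .
qed

end

section \<open>Chernoff bounds for the upper and lower tails\<close>

text \<open>Markov's inequality as nonnegativity of the integral of \<open>f\<close>. Equality would
  give \<open>f = 0\<close> almost surely; as \<open>f\<close> is positive off \<open>A\<close>, the
  event would have probability 1, contradicting \<open>B < 1\<close>.\<close>

lemma chernoff:
  fixes t c :: real and S :: "'a \<Rightarrow> real"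
  assumes [measurable]: "S \<in> borel_measurable M" and int: "integrable M (\<lambda>\<omega>. exp (t * S \<omega>))" and t: "0 \<le> t"
    and E: "(LINT \<omega>|M. exp (t * S \<omega>)) * exp (- (t * c)) \<le> B"
  shows "prob {\<omega> \<in> space M. c \<le> S \<omega>} \<le> B"
    and "B < 1 \<Longrightarrow> prob {\<omega> \<in> space M. c \<le> S \<omega>} < B"
proof -
  define A where "A = {\<omega> \<in> space M. c \<le> S \<omega>}"
  define f where "f \<omega> = exp (t * S \<omega>) * exp (- (t * c)) - indicator A \<omega>" for \<omega>
  have A [measurable]: "A \<in> events" unfolding A_def by measurable
  have A_int: "integrable M (indicat_real A)"
    using A by (simp add: integrable_indicator_iff less_top[symmetric])
  then have f_int: "integrable M f"
    unfolding f_def using int by simp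
  have f_nonneg: "0 \<le> f \<omega>" for \<omega>
  proof (cases "\<omega> \<in> A")
    case True
    then have "t * c \<le> t * S \<omega>" using t by (auto simp: A_def intro: mult_left_mono)
    with True show ?thesis by (simp add: f_def flip: exp_add)
  qed (simp add: f_def)
  have Ef: "(LINT \<omega>|M. f \<omega>) = (LINT \<omega>|M. exp (t * S \<omega>)) * exp (- (t * c)) - prob A"
    unfolding f_def using int A_int A by simp
  moreover have "0 \<le> (LINT \<omega>|M. f \<omega>)"
    using f_nonneg by simp
  ultimately have le: "prob A \<le> (LINT \<omega>|M. exp (t * S \<omega>)) * exp (- (t * c))" by simp
  with E show "prob {\<omega> \<in> space M. c \<le> S \<omega>} \<le> B" unfolding A_def by linarith
  show "prob {\<omega> \<in> space M. c \<le> S \<omega>} < B" if B: "B < 1"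
  proof (rule ccontr)
    assume "\<not> prob {\<omega> \<in> space M. c \<le> S \<omega>} < B"
    then have "(LINT \<omega>|M. f \<omega>) = 0" using le E Ef by (simp add: A_def)
    then have "AE \<omega> in M. f \<omega> = 0"
      using f_int f_nonneg by (subst (asm) integral_nonneg_eq_0_iff_AE) auto
    then have "AE \<omega> in M. \<omega> \<in> A"
      by eventually_elim (rule ccontr, simp add: f_def)
    then have "prob A = 1" using A by (simp add: prob_eq_1)
    then show False using le E B by linarith
  qed
qed

text \<open>This \<open>t\<close> minimises the left side of the identity: \<open>exp t\<close> is
  the ratio of the odds of \<open>z\<close> to the odds of \<open>\<theta>\<close>.\<close>

lemma chernoff_exponent:
  assumes "0 < \<theta>" "\<theta> < z" "z < 1"
  defines "t \<equiv> ln ((1 - \<theta>) / (1 - z)) - ln (\<theta> / z)"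
  shows "0 \<le> t" "exp (- (t * z)) * (1 - \<theta> + \<theta> * exp t) = exp (neg_kl z \<theta>)"
proof -
  have "0 \<le> ln ((1 - \<theta>) / (1 - z))" using assms by simp
  moreover have "ln (\<theta> / z) \<le> 0" using assms by simp
  ultimately show "0 \<le> t" unfolding t_def by linarith
  have "exp t = ((1 - \<theta>) / (1 - z)) / (\<theta> / z)"
    using assms by (simp add: t_def exp_diff)
  then have "1 - \<theta> + \<theta> * exp t = (1 - \<theta>) / (1 - z)"
    using assms by (simp add: field_simps)
  also have "\<dots> = exp (ln ((1 - \<theta>) / (1 - z)))" using assms by simp
  finally show "exp (- (t * z)) * (1 - \<theta> + \<theta> * exp t) = exp (neg_kl z \<theta>)"
    by (simp add: neg_kl_def t_def algebra_simps flip: exp_add)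
qed

text \<open>Only at \<open>z = 1\<close> can the Chernoff bound be attained; it is a limit \<open>t \<longlongrightarrow> \<infinity>\<close> there.\<close>

lemma bernM_upper_tail:
  fixes z \<theta> :: real and n :: nat and S :: "'a \<Rightarrow> real"
  assumes S: "S \<in> borel_measurable M" and bnd: "AE \<omega> in M. S \<omega> \<le> real n" and n: "n > 0"
    and int: "\<And>t. integrable M (\<lambda>\<omega>. exp (t * S \<omega>))"
    and mgf: "\<And>t. (LINT \<omega>|M. exp (t * S \<omega>)) \<le> (1 - \<theta> + \<theta> * exp t) ^ n"
    and th: "0 \<le> \<theta>" "\<theta> < z"
  defines "p \<equiv> prob {\<omega> \<in> space M. real n * z \<le> S \<omega>}"
  shows "bernM z \<theta> = - \<infinity> \<Longrightarrow> p = 0"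
    and "bernM z \<theta> = ereal m \<Longrightarrow> p \<le> exp (real n * m)"
    and "bernM z \<theta> = ereal m \<Longrightarrow> z \<noteq> 1 \<Longrightarrow> p < exp (real n * m)"
proof -
  have E: "(LINT \<omega>|M. exp (t * S \<omega>)) * exp (- (t * (real n * z)))
      \<le> (exp (- (t * z)) * (1 - \<theta> + \<theta> * exp t)) ^ n" for t
  proof -
    have "exp (- (t * (real n * z))) = exp (- (t * z)) ^ n"
      by (simp add: algebra_simps flip: exp_of_nat_mult)
    then show ?thesis using mgf[of t] by (simp add: power_mult_distrib mult.commute)
  qed
  have p: "p \<le> (exp (- (t * z)) * (1 - \<theta> + \<theta> * exp t)) ^ n" if "0 \<le> t" for t
    unfolding p_def by (rule chernoff(1)[OF S int that E])
  \<comment> \<open>For the degenerate cases \<open>\<theta> = 0\<close> and \<open>z = 1\<close>,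
    where the best bound arises only as \<open>t\<close> tends to infinity.\<close>
  have lim: "p \<le> L ^ n" if "((\<lambda>t. exp (- (t * z)) * (1 - \<theta> + \<theta> * exp t)) \<longlongrightarrow> L) at_top" for L
  proof (rule tendsto_lowerbound)
    show "((\<lambda>t. (exp (- (t * z)) * (1 - \<theta> + \<theta> * exp t)) ^ n) \<longlongrightarrow> L ^ n) at_top"
      using that by (rule tendsto_power)
    show "\<forall>\<^sub>F t in at_top. p \<le> (exp (- (t * z)) * (1 - \<theta> + \<theta> * exp t)) ^ n"
      using eventually_ge_at_top[of 0] by eventually_elim (rule p)
  qed simp
  have p0: "0 \<le> p" by (simp add: p_def)
  show "p = 0" if "bernM z \<theta> = - \<infinity>"
  \<comment> \<open>Given \<open>0 \<le> \<theta> < z\<close>, the value minus infinity means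
    \<open>\<theta> = 0\<close>, where the bound tends to 0, or \<open>z > 1\<close>, which puts the
    threshold above \<open>real n\<close>.\<close>
  proof (cases "z \<le> 1")
    case True
    then have th0: "\<theta> = 0" "0 < z" using that th by (auto simp: bernM_eq_neg_kl split: if_splits)
    have "((\<lambda>t. exp (- (t * z))) \<longlongrightarrow> 0) at_top" using th0 by real_asymp
    then have "p \<le> 0 ^ n" using lim[of 0] th0 by simp
    then show ?thesis using n p0 by (simp add: zero_power)
  next
    case False
    have "AE \<omega> in M. \<not> real n * z \<le> S \<omega>"
      using bnd
    proof eventually_elim
      case (elim \<omega>)
      have "real n * 1 < real n * z" using False n by (intro mult_strict_left_mono) auto
      with elim show ?case by linarith
    qed
    then show ?thesis unfolding p_def using S by (subst prob_Collect_eq_0) auto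
  qed
  show "p < exp (real n * m)" if m: "bernM z \<theta> = ereal m" and z: "z \<noteq> 1"
  proof -
    have *: "0 < \<theta>" "z < 1" "m = neg_kl z \<theta>"
      using m z th by (auto simp: bernM_eq_neg_kl split: if_splits)
    define t where "t = ln ((1 - \<theta>) / (1 - z)) - ln (\<theta> / z)"
    have t: "0 \<le> t" "exp (- (t * z)) * (1 - \<theta> + \<theta> * exp t) = exp m"
      using chernoff_exponent[of \<theta> z] * th unfolding t_def by auto
    \<comment> \<open>Brings the bound below 1, as the strict form of \<open>chernoff\<close>
      requires.\<close>
    have "m < 0"
    proof -
      have "0 < (z - \<theta>)\<^sup>2" using th by simp
      then show ?thesis using neg_kl_le_neg_square[of z \<theta>] * th by linarith
    qed
    then have "exp m ^ n < 1" using n by (simp add: power_less_one_iff)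
    then have "p < exp m ^ n"
      unfolding p_def using E[of t] unfolding t(2) by (intro chernoff(2)[OF S int t(1)])
    then show ?thesis by (simp add: exp_of_nat_mult)
  qed
  show "p \<le> exp (real n * m)" if m: "bernM z \<theta> = ereal m"
  proof (cases "z = 1")
    case True
    then have *: "m = ln \<theta>" "0 < \<theta>"
      using m by (auto simp: bernM_eq_neg_kl neg_kl_def split: if_splits)
    have "((\<lambda>t. exp (- t) * (1 - \<theta>) + \<theta>) \<longlongrightarrow> 0 * (1 - \<theta>) + \<theta>) at_top"
      by (intro tendsto_intros) real_asymp
    moreover have "exp (- t) * (1 - \<theta>) + \<theta> = exp (- (t * z)) * (1 - \<theta> + \<theta> * exp t)" for t
      using True by (simp add: algebra_simps flip: exp_add)
    ultimately have "p \<le> \<theta> ^ n" by (intro lim) simp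
    then show ?thesis using * by (simp add: exp_of_nat_mult)
  next
    case False
    then show ?thesis using \<open>bernM z \<theta> = ereal m \<Longrightarrow> z \<noteq> 1 \<Longrightarrow> p < exp (real n * m)\<close> m by simp
  qed
qed

text \<open>The upper tail bound applied to \<open>real n - S \<omega>\<close>, with
  \<open>1 - z\<close> and \<open>1 - \<theta>\<close> as parameters.\<close>

lemma bernM_lower_tail:
  fixes z \<theta> :: real and n :: nat and S :: "'a \<Rightarrow> real"
  assumes S: "S \<in> borel_measurable M" and bnd: "AE \<omega> in M. 0 \<le> S \<omega>" and n: "n > 0"
    and int: "\<And>t. integrable M (\<lambda>\<omega>. exp (t * S \<omega>))"
    and mgf: "\<And>t. (LINT \<omega>|M. exp (t * S \<omega>)) \<le> (1 - \<theta> + \<theta> * exp t) ^ n"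
    and th: "\<theta> \<le> 1" "z < \<theta>"
  defines "p \<equiv> prob {\<omega> \<in> space M. S \<omega> \<le> real n * z}"
  shows "bernM z \<theta> = - \<infinity> \<Longrightarrow> p = 0"
    and "bernM z \<theta> = ereal m \<Longrightarrow> p \<le> exp (real n * m)"
    and "bernM z \<theta> = ereal m \<Longrightarrow> z \<noteq> 0 \<Longrightarrow> p < exp (real n * m)"
proof -
  define R where "R \<omega> = real n - S \<omega>" for \<omega>
  have R: "exp (t * R \<omega>) = exp t ^ n * exp (- t * S \<omega>)" for t \<omega>
    by (simp add: R_def algebra_simps flip: exp_add exp_of_nat_mult)
  have R_meas: "R \<in> borel_measurable M" unfolding R_def using S by measurable
  have R_bnd: "AE \<omega> in M. R \<omega> \<le> real n" using bnd by eventually_elim (simp add: R_def)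
  have R_int: "integrable M (\<lambda>\<omega>. exp (t * R \<omega>))" for t
    unfolding R using int[of "- t"] by simp
  have R_mgf: "(LINT \<omega>|M. exp (t * R \<omega>)) \<le> (1 - (1 - \<theta>) + (1 - \<theta>) * exp t) ^ n" for t
  proof -
    have "(LINT \<omega>|M. exp (t * R \<omega>)) = exp t ^ n * (LINT \<omega>|M. exp (- t * S \<omega>))"
      unfolding R by simp
    also have "\<dots> \<le> exp t ^ n * (1 - \<theta> + \<theta> * exp (- t)) ^ n"
      by (intro mult_left_mono mgf) auto
    also have "\<dots> = (1 - (1 - \<theta>) + (1 - \<theta>) * exp t) ^ n"
      by (simp add: algebra_simps flip: power_mult_distrib exp_add)
    finally show ?thesis .
  qed
  have p: "p = prob {\<omega> \<in> space M. real n * (1 - z) \<le> R \<omega>}"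
    unfolding p_def R_def by (simp add: algebra_simps)
  note tail = bernM_upper_tail[where z = "1 - z", OF R_meas R_bnd n R_int R_mgf]
  show "bernM z \<theta> = - \<infinity> \<Longrightarrow> p = 0"
    "bernM z \<theta> = ereal m \<Longrightarrow> p \<le> exp (real n * m)"
    "bernM z \<theta> = ereal m \<Longrightarrow> z \<noteq> 0 \<Longrightarrow> p < exp (real n * m)"
    unfolding p using th by (auto intro!: tail simp: bernM_reflect)
qed

end

section \<open>Sufficiency of the sample size and the final theorem\<close>

lemma (in prob_space) sample_size_sufficient:
  fixes a b \<delta> e r \<mu> :: real and n :: nat and X :: "nat \<Rightarrow> 'a \<Rightarrow> real"
  assumes ab: "a < b" and d: "0 < \<delta>" and e: "0 < e" and r: "0 < r" "r < 1" and n: "n > 0"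
    and size: "ereal (real n) \<ge> ereal (ln (\<delta> / 2)) / (SUP \<nu>\<in>{a..b}. Wfun a b e r \<nu>)"
    and mu: "\<mu> \<in> {a..b}"
    and meas: "\<And>k. k \<ge> 1 \<Longrightarrow> X k \<in> borel_measurable M"
    and bnd: "\<And>k. k \<ge> 1 \<Longrightarrow> AE \<omega> in M. a \<le> X k \<omega> \<and> X k \<omega> \<le> b"
    and cexp: "\<And>k. k \<ge> 1 \<Longrightarrow> AE \<omega> in M. real_cond_exp M (gen_alg M X (k - 1)) (X k) \<omega> = \<mu>"
  shows "prob {\<omega> \<in> space M. \<bar>(\<Sum>i=1..n. X i \<omega>) / real n - \<mu>\<bar> < e
                          \<or> \<bar>(\<Sum>i=1..n. X i \<omega>) / real n - \<mu>\<bar> < r * \<bar>\<mu>\<bar>} > 1 - \<delta>"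
proof -
  define \<theta> g h where "\<theta> = theta a b \<mu>" and "g = gfun a b e r \<mu>" and "h = hfun a b e r \<mu>"
  define w where "w = max e (r * \<bar>\<mu>\<bar>)"
  define S where "S \<omega> = ((\<Sum>i=1..n. X i \<omega>) - real n * a) / (b - a)" for \<omega>
  note norm_sum = mgf_normalized_sum[OF ab mu meas bnd cexp, where n = n, folded S_def \<theta>_def]
  have S: "S \<in> borel_measurable M" "AE \<omega> in M. 0 \<le> S \<omega>" "AE \<omega> in M. S \<omega> \<le> real n"
    "\<And>t. integrable M (\<lambda>\<omega>. exp (t * S \<omega>))"
    "\<And>t. (LINT \<omega>|M. exp (t * S \<omega>)) \<le> (1 - \<theta> + \<theta> * exp t) ^ n"
    using norm_sum by auto
  have th: "0 \<le> \<theta>" "\<theta> \<le> 1" "g < \<theta>" "\<theta> < h"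
    using theta_bounds[OF ab mu] gfun_less_theta[OF ab e] by (simp_all add: \<theta>_def g_def h_def)
  define U L where "U = {\<omega> \<in> space M. real n * h \<le> S \<omega>}" and "L = {\<omega> \<in> space M. S \<omega> \<le> real n * g}"
  have UL: "U \<in> events" "L \<in> events"
    using S(1) unfolding U_def L_def by measurable
  note upper = bernM_upper_tail[OF S(1,3) n S(4,5) th(1,4), folded U_def]
  note lower = bernM_lower_tail[OF S(1,2) n S(4,5) th(2,3), folded L_def]
  \<comment> \<open>Stated for any \<open>\<nu>\<close>, since it serves both at
    \<open>\<mu>\<close> and at a point off the midpoint. The supremum lies between \<open>m\<close>
    and \<open>- k\<close>, hence is a negative real, and the quotient can be cleared.\<close>
  have exp_le: "exp (real n * m) \<le> \<delta> / 2" if "\<nu> \<in> {a..b}" "ereal m \<le> Wfun a b e r \<nu>" for m \<nu>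
  proof -
    define k where "k = (e / (b - a))\<^sup>2 / 4"
    have k: "k > 0" using e ab by (simp add: k_def)
    have le: "(SUP \<nu>\<in>{a..b}. Wfun a b e r \<nu>) \<le> ereal (- k)"
      unfolding k_def by (intro SUP_least Wfun_le ab e)
    have ge: "ereal m \<le> (SUP \<nu>\<in>{a..b}. Wfun a b e r \<nu>)"
      using that by (meson SUP_upper order_trans)
    obtain s where s: "(SUP \<nu>\<in>{a..b}. Wfun a b e r \<nu>) = ereal s"
      using le ge by (cases "SUP \<nu>\<in>{a..b}. Wfun a b e r \<nu>") auto
    have "m \<le> s" "s < 0" using le ge k unfolding s by auto
    have "ln (\<delta> / 2) / s \<le> real n"
      using size \<open>s < 0\<close> unfolding s by simp
    then have "real n * s \<le> ln (\<delta> / 2)"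
      using \<open>s < 0\<close> by (simp add: divide_le_eq)
    moreover have "real n * m \<le> real n * s"
      using \<open>m \<le> s\<close> by (intro mult_left_mono) auto
    ultimately have "exp (real n * m) \<le> exp (ln (\<delta> / 2))" by simp
    then show ?thesis using d by simp
  qed
  have W: "bernM g \<theta> \<le> Wfun a b e r \<mu>" "bernM h \<theta> \<le> Wfun a b e r \<mu>"
    by (simp_all add: Wfun_def g_def h_def \<theta>_def)
  have bernM_cases: "bernM z \<theta> = - \<infinity> \<or> (\<exists>m. bernM z \<theta> = ereal m)" for z
    by (auto simp: bernM_eq_neg_kl)
  \<comment> \<open>At the value minus infinity the tail is null. This also covers a supremum of
    minus infinity, where the size condition reads \<open>n \<ge> 0\<close>.\<close>
  have U_le: "prob U \<le> \<delta> / 2" and U_less: "h \<noteq> 1 \<Longrightarrow> prob U < \<delta> / 2"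
    using bernM_cases[of h] upper exp_le[OF mu] W(2) d
    by (metis half_gt_zero less_eq_real_def order_trans, metis half_gt_zero order_less_le_trans)
  have L_le: "prob L \<le> \<delta> / 2" and L_less: "g \<noteq> 0 \<Longrightarrow> prob L < \<delta> / 2"
    using bernM_cases[of g] lower exp_le[OF mu] W(1) d
    by (metis half_gt_zero less_eq_real_def order_trans, metis half_gt_zero order_less_le_trans)
  have "prob U + prob L < \<delta>"
  proof (cases "g = 0 \<and> h = 1")
    case True
    \<comment> \<open>At the midpoint the upper tail is at most \<open>exp (- n * ln 2)\<close>,
      which is strictly below the bound \<open>exp (- n * ln 3 / 2)\<close> obtained from
      \<open>v\<close>, as 3 < 4.\<close>
    then obtain v where v: "v \<in> {a..b}" "ereal (- ln 3 / 2) \<le> Wfun a b e r v"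
      using Wfun_off_midpoint[OF ab e r] unfolding g_def h_def by blast
    have half: "\<theta> = 1/2" using True unfolding g_def h_def \<theta>_def gfun_def hfun_def by linarith
    have "bernM h \<theta> = ereal (- ln 2)"
      using True by (simp add: bernM_eq_neg_kl neg_kl_def half ln_div)
    then have "prob U \<le> exp (real n * - ln 2)" by (rule upper(2))
    also have "ln 3 < ln (2 * 2 :: real)" by simp
    then have "ln 3 < 2 * ln (2 :: real)" by (subst (asm) ln_mult) auto
    then have "real n * - ln 2 < real n * (- ln 3 / 2)"
      using n by (intro mult_strict_left_mono) auto
    then have "exp (real n * - ln 2) < exp (real n * (- ln 3 / 2))" by simp
    also have "\<dots> \<le> \<delta> / 2" using exp_le[OF v] .
    finally show ?thesis using L_le by simp
  next
    case False
    then show ?thesis using U_le U_less L_le L_less by (cases "h = 1") force+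
  qed
  moreover have "prob (U \<union> L) \<le> prob U + prob L"
    using UL by (rule measure_Un_le)
  moreover have "prob (space M - (U \<union> L)) = 1 - prob (U \<union> L)"
    using UL by (intro prob_compl) auto
  moreover have "{\<omega> \<in> space M. \<bar>(\<Sum>i=1..n. X i \<omega>) / real n - \<mu>\<bar> < e
                          \<or> \<bar>(\<Sum>i=1..n. X i \<omega>) / real n - \<mu>\<bar> < r * \<bar>\<mu>\<bar>} = space M - (U \<union> L)"
  proof -
    \<comment> \<open>Undoing the normalisation turns \<open>h\<close> and \<open>g\<close> into
      \<open>\<mu> + w\<close> and \<open>\<mu> - w\<close>. The tails are closed, so their
      complement is the event with strict inequalities.\<close>
    have "(real n * h \<le> S \<omega> \<longleftrightarrow> \<mu> + w \<le> (\<Sum>i=1..n. X i \<omega>) / real n) \<and>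
          (S \<omega> \<le> real n * g \<longleftrightarrow> (\<Sum>i=1..n. X i \<omega>) / real n \<le> \<mu> - w)" for \<omega>
    proof -
      have eq: "S \<omega> = real n * (((\<Sum>i=1..n. X i \<omega>) / real n - a) / (b - a))"
        using n by (simp add: S_def right_diff_distrib)
      have "h = (\<mu> + w - a) / (b - a)" "g = (\<mu> - w - a) / (b - a)"
        by (simp_all add: h_def g_def hfun_def gfun_def theta_def w_def
            diff_divide_distrib add_divide_distrib)
      then show ?thesis unfolding eq using n ab by (simp add: divide_le_cancel)
    qed
    moreover have "\<bar>x - \<mu>\<bar> < e \<or> \<bar>x - \<mu>\<bar> < r * \<bar>\<mu>\<bar> \<longleftrightarrow> \<not> (\<mu> + w \<le> x \<or> x \<le> \<mu> - w)" for x
      unfolding w_def by linarith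
    ultimately show ?thesis unfolding U_def L_def by blast
  qed
  ultimately show ?thesis by simp
qed

theorem theorem2:
  fixes a b \<delta> \<epsilon>a \<epsilon>r :: real
  assumes "a < b" and "0 < \<delta>" and "\<delta> < 1" and "0 < \<epsilon>a" and "0 < \<epsilon>r" and "\<epsilon>r < 1"
  shows
    "(\<forall>(n::nat) (\<mu>::real) (P::'w measure) (X::nat \<Rightarrow> 'w \<Rightarrow> real).
        n > 0 \<longrightarrow>
        ereal (real n) \<ge> ereal (ln (\<delta> / 2)) / (SUP \<nu>\<in>{a..b}. Wfun a b \<epsilon>a \<epsilon>r \<nu>) \<longrightarrow>
        \<mu> \<in> {a..b} \<longrightarrow>
        prob_space P \<longrightarrow>
        (\<forall>k\<ge>1. X k \<in> borel_measurable P) \<longrightarrow>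
        (\<forall>k\<ge>1. AE \<omega> in P. a \<le> X k \<omega> \<and> X k \<omega> \<le> b
                  \<and> real_cond_exp P (gen_alg P X (k - 1)) (X k) \<omega> = \<mu>) \<longrightarrow>
        measure P {\<omega> \<in> space P. \<bar>(\<Sum>i=1..n. X i \<omega>) / real n - \<mu>\<bar> < \<epsilon>a
                              \<or> \<bar>(\<Sum>i=1..n. X i \<omega>) / real n - \<mu>\<bar> < \<epsilon>r * \<bar>\<mu>\<bar>} > 1 - \<delta>)
     \<and>
     (\<forall>c d \<nu> :: real.
        {c..d} \<subseteq> {a..b} \<longrightarrow> \<nu> \<in> {c..d} \<longrightarrow>
        gfun a b \<epsilon>a \<epsilon>r d \<le> theta a b c \<longrightarrow>
        theta a b c \<le> theta a b d \<longrightarrow>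
        theta a b d \<le> hfun a b \<epsilon>a \<epsilon>r c \<longrightarrow>
        (\<not> (gfun a b \<epsilon>a \<epsilon>r \<nu> = 0 \<and> theta a b c = 0) \<longrightarrow>
         \<not> (hfun a b \<epsilon>a \<epsilon>r \<nu> = 1 \<and> theta a b d = 1) \<longrightarrow>
         Wfun a b \<epsilon>a \<epsilon>r \<nu> \<le> max (bernM (gfun a b \<epsilon>a \<epsilon>r d) (theta a b c))
                                (bernM (hfun a b \<epsilon>a \<epsilon>r c) (theta a b d)))
        \<and>
        Wfun a b \<epsilon>a \<epsilon>r \<nu> \<ge> max (bernM (gfun a b \<epsilon>a \<epsilon>r c) (theta a b d))
                                (bernM (hfun a b \<epsilon>a \<epsilon>r d) (theta a b c)))"
proof (intro conjI allI impI)
  fix n \<mu> and P :: "'w measure" and X :: "nat \<Rightarrow> 'w \<Rightarrow> real"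
  assume n: "n > 0"
    and size: "ereal (real n) \<ge> ereal (ln (\<delta> / 2)) / (SUP \<nu>\<in>{a..b}. Wfun a b \<epsilon>a \<epsilon>r \<nu>)"
    and mu: "\<mu> \<in> {a..b}" and "prob_space P"
    and meas: "\<forall>k\<ge>1. X k \<in> borel_measurable P"
    and X: "\<forall>k\<ge>1. AE \<omega> in P. a \<le> X k \<omega> \<and> X k \<omega> \<le> b
                  \<and> real_cond_exp P (gen_alg P X (k - 1)) (X k) \<omega> = \<mu>"
  interpret prob_space P by fact
  show "prob {\<omega> \<in> space P. \<bar>(\<Sum>i=1..n. X i \<omega>) / real n - \<mu>\<bar> < \<epsilon>a
                              \<or> \<bar>(\<Sum>i=1..n. X i \<omega>) / real n - \<mu>\<bar> < \<epsilon>r * \<bar>\<mu>\<bar>} > 1 - \<delta>"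
    using meas X by (intro sample_size_sufficient[OF assms(1,2,4-6) n size mu]) auto
next
  fix c d \<nu> :: real
  assume v: "\<nu> \<in> {c..d}"
    and cd: "gfun a b \<epsilon>a \<epsilon>r d \<le> theta a b c" "theta a b d \<le> hfun a b \<epsilon>a \<epsilon>r c"
  show "max (bernM (gfun a b \<epsilon>a \<epsilon>r c) (theta a b d)) (bernM (hfun a b \<epsilon>a \<epsilon>r d) (theta a b c))
      \<le> Wfun a b \<epsilon>a \<epsilon>r \<nu>"
    using assms v by (intro Wfun_lower_bound)
  assume "\<not> (gfun a b \<epsilon>a \<epsilon>r \<nu> = 0 \<and> theta a b c = 0)" "\<not> (hfun a b \<epsilon>a \<epsilon>r \<nu> = 1 \<and> theta a b d = 1)"
  then show "Wfun a b \<epsilon>a \<epsilon>r \<nu>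
      \<le> max (bernM (gfun a b \<epsilon>a \<epsilon>r d) (theta a b c)) (bernM (hfun a b \<epsilon>a \<epsilon>r c) (theta a b d))"
    using assms v cd by (intro Wfun_upper_bound)
qed

end
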